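(* Let $\mathscr A$ be a profinitary exact category. Then its Grothendieck monoid $\Gamma_{\mathscr A}$ is naturally ordered, i.e. the preorder $\preceq$ on $\Gamma_{\mathscr A}$ given by $\alpha\preceq\beta$ if and only if $\beta=\alpha+\gamma$ for some $\gamma\in\Gamma_{\mathscr A}$ is a partial order, and $\Gamma_{\mathscr A}$ is generated, as a monoid, by the minimal elements of $\Gamma_{\mathscr A}^+=\Gamma_{\mathscr A}\setminus\{0\}$ with respect to $\preceq$.
   Context: All categories are essentially small; exact categories are in the sense of Quillen. $\mathrm{Iso}\,\mathscr A$ is the set of isomorphism classes $[X]$ of objects, an abelian monoid under $[X]+[Y]=[X\oplus Y]$. $\underline{\mathrm{Ext}}^1_{\mathscr A}(A,B)$ is the set of all $[X]$ such that there is a short exact sequence $B\rightarrowtail X\twoheadrightarrow A$. The Grothendieck monoid $\Gamma_{\mathscr A}$ is the quotient of $\mathrm{Iso}\,\mathscr A$ by the congruence which is the transitive closure of: $[X]\equiv[Y]$ if $[X],[Y]\in\underline{\mathrm{Ext}}^1_{\mathscr A}(M,N)$ for some $M,N$; $|X|$ is the image of $X$ in $\Gamma_{\mathscr A}$. An exact category $\mathscr A$ is profinitary if all Hom sets are finite and $\{[X]\in\mathrm{Iso}\,\mathscr A:|X|=\gamma\}$ is finite for every $\gamma\in\Gamma_{\mathscr A}$. *)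

theory Defs
  imports "HOL-Algebra.Group"
begin

section \<open>Categories\<close>

text \<open>
  A category has a set of objects and a set of arrows, every arrow carrying its source and target,
  so that Hom sets are disjoint. \<open>g \<odot> f\<close> (first \<open>f\<close>, then \<open>g\<close>) is meaningful only if the
  target of \<open>f\<close> is the source of \<open>g\<close>. As objects and arrows form sets, all categories here are small.
\<close>

record ('o, 'm) category_data =
  objects :: "'o set"
  arrows :: "'m set"
  source :: "'m \<Rightarrow> 'o"
  target :: "'m \<Rightarrow> 'o"
  ident :: "'o \<Rightarrow> 'm"
  compose :: "'m \<Rightarrow> 'm \<Rightarrow> 'm"  (infixl "\<odot>\<index>" 75)

definition Hom :: "('o, 'm, 'x) category_data_scheme \<Rightarrow> 'o \<Rightarrow> 'o \<Rightarrow> 'm set"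
  where "Hom C X Y = {f \<in> arrows C. source C f = X \<and> target C f = Y}"

locale category =
  fixes C :: "('o, 'm, 'x) category_data_scheme" (structure)
  assumes source_in: "f \<in> arrows C \<Longrightarrow> source C f \<in> objects C"
    and target_in: "f \<in> arrows C \<Longrightarrow> target C f \<in> objects C"
    and ident_in: "X \<in> objects C \<Longrightarrow> ident C X \<in> Hom C X X"
    and compose_in: "f \<in> Hom C X Y \<Longrightarrow> g \<in> Hom C Y Z \<Longrightarrow> g \<odot> f \<in> Hom C X Z"
    and compose_assoc: "f \<in> Hom C W X \<Longrightarrow> g \<in> Hom C X Y \<Longrightarrow> h \<in> Hom C Y Z \<Longrightarrow>
      h \<odot> g \<odot> f = h \<odot> (g \<odot> f)"
    and ident_left: "f \<in> Hom C X Y \<Longrightarrow> ident C Y \<odot> f = f"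
    and ident_right: "f \<in> Hom C X Y \<Longrightarrow> f \<odot> ident C X = f"

definition isomorphism :: "('o, 'm, 'x) category_data_scheme \<Rightarrow> 'm \<Rightarrow> bool"
  where "isomorphism C f \<longleftrightarrow> f \<in> arrows C \<and>
    (\<exists>g \<in> Hom C (target C f) (source C f).
       compose C g f = ident C (source C f) \<and> compose C f g = ident C (target C f))"

definition isomorphic :: "('o, 'm, 'x) category_data_scheme \<Rightarrow> 'o \<Rightarrow> 'o \<Rightarrow> bool"
  where "isomorphic C X Y \<longleftrightarrow> (\<exists>f \<in> Hom C X Y. isomorphism C f)"

definition zero_object :: "('o, 'm, 'x) category_data_scheme \<Rightarrow> 'o \<Rightarrow> bool"
  where "zero_object C Z \<longleftrightarrow> Z \<in> objects C \<and>
    (\<forall>X \<in> objects C. (\<exists>!f. f \<in> Hom C X Z) \<and> (\<exists>!f. f \<in> Hom C Z X))"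

definition pullback :: "('o, 'm, 'x) category_data_scheme \<Rightarrow> 'm \<Rightarrow> 'm \<Rightarrow> 'm \<Rightarrow> 'm \<Rightarrow> bool"
  \<comment> \<open>\<open>p'\<close> is the base change of \<open>p : Y \<rightarrow> Z\<close> along \<open>f : W \<rightarrow> Z\<close>, with \<open>f' : P \<rightarrow> Y\<close>, \<open>p' : P \<rightarrow> W\<close>\<close>
  where "pullback C p f p' f' \<longleftrightarrow>
    p \<in> arrows C \<and> f \<in> arrows C \<and> target C p = target C f \<and>
    (\<exists>P \<in> objects C. f' \<in> Hom C P (source C p) \<and> p' \<in> Hom C P (source C f) \<and>
       compose C p f' = compose C f p' \<and>
       (\<forall>T \<in> objects C. \<forall>u \<in> Hom C T (source C p). \<forall>v \<in> Hom C T (source C f).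
          compose C p u = compose C f v \<longrightarrow>
          (\<exists>!t. t \<in> Hom C T P \<and> compose C f' t = u \<and> compose C p' t = v)))"

definition pushout :: "('o, 'm, 'x) category_data_scheme \<Rightarrow> 'm \<Rightarrow> 'm \<Rightarrow> 'm \<Rightarrow> 'm \<Rightarrow> bool"
  \<comment> \<open>\<open>i'\<close> is the cobase change of \<open>i : X \<rightarrow> Y\<close> along \<open>f : X \<rightarrow> W\<close>, with \<open>f' : Y \<rightarrow> P\<close>, \<open>i' : W \<rightarrow> P\<close>\<close>
  where "pushout C i f i' f' \<longleftrightarrow>
    i \<in> arrows C \<and> f \<in> arrows C \<and> source C i = source C f \<and>
    (\<exists>P \<in> objects C. f' \<in> Hom C (target C i) P \<and> i' \<in> Hom C (target C f) P \<and>
       compose C f' i = compose C i' f \<and>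
       (\<forall>T \<in> objects C. \<forall>u \<in> Hom C (target C i) T. \<forall>v \<in> Hom C (target C f) T.
          compose C u i = compose C v f \<longrightarrow>
          (\<exists>!t. t \<in> Hom C P T \<and> compose C t f' = u \<and> compose C t i' = v)))"


section \<open>Additive categories\<close>

record ('o, 'm) additive_data = "('o, 'm) category_data" +
  arr_add :: "'m \<Rightarrow> 'm \<Rightarrow> 'm"  (infixl "\<boxplus>\<index>" 65)
  arr_zero :: "'o \<Rightarrow> 'o \<Rightarrow> 'm"

definition Hom_group :: "('o, 'm, 'x) additive_data_scheme \<Rightarrow> 'o \<Rightarrow> 'o \<Rightarrow> 'm monoid"
  where "Hom_group C X Y = \<lparr>carrier = Hom C X Y, mult = arr_add C, one = arr_zero C X Y\<rparr>"

definition biproduct ::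
    "('o, 'm, 'x) additive_data_scheme \<Rightarrow> 'o \<Rightarrow> 'o \<Rightarrow> 'o \<Rightarrow> 'm \<Rightarrow> 'm \<Rightarrow> 'm \<Rightarrow> 'm \<Rightarrow> bool"
  where "biproduct C X Y S i\<^sub>1 i\<^sub>2 p\<^sub>1 p\<^sub>2 \<longleftrightarrow>
    X \<in> objects C \<and> Y \<in> objects C \<and> S \<in> objects C \<and>
    i\<^sub>1 \<in> Hom C X S \<and> i\<^sub>2 \<in> Hom C Y S \<and> p\<^sub>1 \<in> Hom C S X \<and> p\<^sub>2 \<in> Hom C S Y \<and>
    compose C p\<^sub>1 i\<^sub>1 = ident C X \<and> compose C p\<^sub>2 i\<^sub>2 = ident C Y \<and>
    compose C p\<^sub>1 i\<^sub>2 = arr_zero C Y X \<and> compose C p\<^sub>2 i\<^sub>1 = arr_zero C X Y \<and>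
    arr_add C (compose C i\<^sub>1 p\<^sub>1) (compose C i\<^sub>2 p\<^sub>2) = ident C S"

definition direct_sum :: "('o, 'm, 'x) additive_data_scheme \<Rightarrow> 'o \<Rightarrow> 'o \<Rightarrow> 'o \<Rightarrow> bool"
  where "direct_sum C X Y S \<longleftrightarrow> (\<exists>i\<^sub>1 i\<^sub>2 p\<^sub>1 p\<^sub>2. biproduct C X Y S i\<^sub>1 i\<^sub>2 p\<^sub>1 p\<^sub>2)"

locale additive_category = category C
  for C :: "('o, 'm, 'x) additive_data_scheme" (structure) +
  assumes Hom_comm_group: "X \<in> objects C \<Longrightarrow> Y \<in> objects C \<Longrightarrow> comm_group (Hom_group C X Y)"
    and compose_add_right: "f \<in> Hom C X Y \<Longrightarrow> f' \<in> Hom C X Y \<Longrightarrow> g \<in> Hom C Y Z \<Longrightarrow>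
      g \<odot> (f \<boxplus> f') = g \<odot> f \<boxplus> g \<odot> f'"
    and compose_add_left: "f \<in> Hom C X Y \<Longrightarrow> g \<in> Hom C Y Z \<Longrightarrow> g' \<in> Hom C Y Z \<Longrightarrow>
      (g \<boxplus> g') \<odot> f = g \<odot> f \<boxplus> g' \<odot> f"
    and ex_zero_object: "\<exists>Z. zero_object C Z"
    and ex_direct_sum: "X \<in> objects C \<Longrightarrow> Y \<in> objects C \<Longrightarrow> \<exists>S. direct_sum C X Y S"

definition is_kernel :: "('o, 'm, 'x) additive_data_scheme \<Rightarrow> 'm \<Rightarrow> 'm \<Rightarrow> bool"
  \<comment> \<open>\<open>i\<close> is a kernel of \<open>p\<close>\<close>
  where "is_kernel C i p \<longleftrightarrow>
    i \<in> arrows C \<and> p \<in> arrows C \<and> target C i = source C p \<and>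
    compose C p i = arr_zero C (source C i) (target C p) \<and>
    (\<forall>T \<in> objects C. \<forall>f \<in> Hom C T (source C p). compose C p f = arr_zero C T (target C p) \<longrightarrow>
       (\<exists>!g. g \<in> Hom C T (source C i) \<and> compose C i g = f))"

definition is_cokernel :: "('o, 'm, 'x) additive_data_scheme \<Rightarrow> 'm \<Rightarrow> 'm \<Rightarrow> bool"
  \<comment> \<open>\<open>p\<close> is a cokernel of \<open>i\<close>\<close>
  where "is_cokernel C p i \<longleftrightarrow>
    i \<in> arrows C \<and> p \<in> arrows C \<and> target C i = source C p \<and>
    compose C p i = arr_zero C (source C i) (target C p) \<and>
    (\<forall>T \<in> objects C. \<forall>f \<in> Hom C (target C i) T. compose C f i = arr_zero C (source C i) T \<longrightarrow>
       (\<exists>!g. g \<in> Hom C (target C p) T \<and> compose C g p = f))"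


section \<open>Exact categories\<close>

text \<open>
  The pairs \<open>(i, p) \<in> short_exact\<close> are the distinguished short exact sequences
  \<open>B \<rightarrowtail> X \<twoheadrightarrow> A\<close>, with \<open>i : B \<rightarrow> X\<close> and \<open>p : X \<rightarrow> A\<close>.
\<close>

record ('o, 'm) exact_data = "('o, 'm) additive_data" +
  short_exact :: "('m \<times> 'm) set"

definition admissible_mono :: "('o, 'm, 'x) exact_data_scheme \<Rightarrow> 'm \<Rightarrow> bool"
  where "admissible_mono C i \<longleftrightarrow> (\<exists>p. (i, p) \<in> short_exact C)"

definition admissible_epi :: "('o, 'm, 'x) exact_data_scheme \<Rightarrow> 'm \<Rightarrow> bool"
  where "admissible_epi C p \<longleftrightarrow> (\<exists>i. (i, p) \<in> short_exact C)"

text \<open>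
  Quillen's original list of axioms (Higher algebraic K-theory I, section 2). The last two are
  his ``obscure'' axioms, which Keller showed to follow from the others.
\<close>

locale exact_category = additive_category C
  for C :: "('o, 'm, 'x) exact_data_scheme" (structure) +
  assumes short_exact_kernel: "(i, p) \<in> short_exact C \<Longrightarrow> is_kernel C i p"
    and short_exact_cokernel: "(i, p) \<in> short_exact C \<Longrightarrow> is_cokernel C p i"
    and short_exact_iso: "(i, p) \<in> short_exact C \<Longrightarrow>
      isomorphism C a \<Longrightarrow> isomorphism C b \<Longrightarrow> isomorphism C c \<Longrightarrow>
      source C a = source C i \<Longrightarrow> source C b = target C i \<Longrightarrow> source C c = target C p \<Longrightarrow>
      i' \<in> Hom C (target C a) (target C b) \<Longrightarrow> p' \<in> Hom C (target C b) (target C c) \<Longrightarrow>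
      i' \<odot> a = b \<odot> i \<Longrightarrow> p' \<odot> b = c \<odot> p \<Longrightarrow> (i', p') \<in> short_exact C"
    and short_exact_split: "biproduct C X Y S i\<^sub>1 i\<^sub>2 p\<^sub>1 p\<^sub>2 \<Longrightarrow> (i\<^sub>1, p\<^sub>2) \<in> short_exact C"
    and admissible_epi_compose: "admissible_epi C p \<Longrightarrow> admissible_epi C q \<Longrightarrow>
      target C p = source C q \<Longrightarrow> admissible_epi C (q \<odot> p)"
    and admissible_mono_compose: "admissible_mono C i \<Longrightarrow> admissible_mono C j \<Longrightarrow>
      target C i = source C j \<Longrightarrow> admissible_mono C (j \<odot> i)"
    and admissible_epi_base_change: "admissible_epi C p \<Longrightarrow> f \<in> arrows C \<Longrightarrow>
      target C f = target C p \<Longrightarrow> \<exists>p' f'. pullback C p f p' f' \<and> admissible_epi C p'"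
    and admissible_mono_cobase_change: "admissible_mono C i \<Longrightarrow> f \<in> arrows C \<Longrightarrow>
      source C f = source C i \<Longrightarrow> \<exists>i' f'. pushout C i f i' f' \<and> admissible_mono C i'"
    and admissible_epi_cancel: "is_kernel C k f \<Longrightarrow> g \<in> arrows C \<Longrightarrow>
      target C g = source C f \<Longrightarrow> admissible_epi C (f \<odot> g) \<Longrightarrow> admissible_epi C f"
    and admissible_mono_cancel: "is_cokernel C k f \<Longrightarrow> g \<in> arrows C \<Longrightarrow>
      source C g = target C f \<Longrightarrow> admissible_mono C (g \<odot> f) \<Longrightarrow> admissible_mono C f"


section \<open>The Grothendieck monoid\<close>

definition iso_class :: "('o, 'm, 'x) category_data_scheme \<Rightarrow> 'o \<Rightarrow> 'o set"
  where "iso_class C X = {Y \<in> objects C. isomorphic C X Y}"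

definition Iso :: "('o, 'm, 'x) category_data_scheme \<Rightarrow> 'o set set"
  where "Iso C = iso_class C ` objects C"

text \<open>
  Direct sums are determined up to isomorphism, and every object isomorphic to a direct sum is one
  itself, so \<open>iso_add C [X] [Y]\<close> is the class \<open>[X \<oplus> Y]\<close>; likewise the zero objects form the
  class \<open>[0]\<close>.
\<close>

definition iso_add :: "('o, 'm, 'x) additive_data_scheme \<Rightarrow> 'o set \<Rightarrow> 'o set \<Rightarrow> 'o set"
  where "iso_add C a b = {S. \<exists>X \<in> a. \<exists>Y \<in> b. direct_sum C X Y S}"

definition iso_zero :: "('o, 'm, 'x) category_data_scheme \<Rightarrow> 'o set"
  where "iso_zero C = {Z. zero_object C Z}"

definition Ext1 :: "('o, 'm, 'x) exact_data_scheme \<Rightarrow> 'o \<Rightarrow> 'o \<Rightarrow> 'o set set"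
  where "Ext1 C A B = {iso_class C X | X.
    X \<in> objects C \<and> (\<exists>i p. (i, p) \<in> short_exact C \<and> i \<in> Hom C B X \<and> p \<in> Hom C X A)}"

definition grothendieck_rel :: "('o, 'm, 'x) exact_data_scheme \<Rightarrow> ('o set \<times> 'o set) set"
  where "grothendieck_rel C =
    {(a, b). \<exists>M \<in> objects C. \<exists>N \<in> objects C. a \<in> Ext1 C M N \<and> b \<in> Ext1 C M N}\<^sup>+"

text \<open>
  The Grothendieck monoid is commutative and written additively in mathematics; here it is an
  instance of the library's monoid record, so its addition appears as \<open>\<otimes>\<close> and its zero as \<open>\<one>\<close>.
\<close>

definition Grothendieck_monoid :: "('o, 'm, 'x) exact_data_scheme \<Rightarrow> 'o set set monoid"
  where "Grothendieck_monoid C =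
    \<lparr>carrier = Iso C // grothendieck_rel C,
     mult = (\<lambda>\<alpha> \<beta>. \<Union>a \<in> \<alpha>. \<Union>b \<in> \<beta>. grothendieck_rel C `` {iso_add C a b}),
     one = grothendieck_rel C `` {iso_zero C}\<rparr>"

definition grothendieck_class :: "('o, 'm, 'x) exact_data_scheme \<Rightarrow> 'o \<Rightarrow> 'o set set"
  where "grothendieck_class C X = grothendieck_rel C `` {iso_class C X}"

locale profinitary_exact_category = exact_category C
  for C :: "('o, 'm, 'x) exact_data_scheme" (structure) +
  assumes finite_Hom: "X \<in> objects C \<Longrightarrow> Y \<in> objects C \<Longrightarrow> finite (Hom C X Y)"
    and finite_fibres: "\<gamma> \<in> carrier (Grothendieck_monoid C) \<Longrightarrow>
      finite {iso_class C X | X. X \<in> objects C \<and> grothendieck_class C X = \<gamma>}"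


section \<open>The natural preorder of a monoid\<close>

definition natural_preorder :: "('a, 'b) monoid_scheme \<Rightarrow> ('a \<times> 'a) set"
  where "natural_preorder G = {(\<alpha>, \<beta>). \<alpha> \<in> carrier G \<and> \<beta> \<in> carrier G \<and>
    (\<exists>\<gamma> \<in> carrier G. \<beta> = \<alpha> \<otimes>\<^bsub>G\<^esub> \<gamma>)}"

definition naturally_ordered :: "('a, 'b) monoid_scheme \<Rightarrow> bool"
  where "naturally_ordered G \<longleftrightarrow> partial_order_on (carrier G) (natural_preorder G)"

definition minimal_nonzero :: "('a, 'b) monoid_scheme \<Rightarrow> 'a set"
  where "minimal_nonzero G = {\<alpha> \<in> carrier G - {\<one>\<^bsub>G\<^esub>}.
    \<forall>\<beta> \<in> carrier G - {\<one>\<^bsub>G\<^esub>}. (\<beta>, \<alpha>) \<in> natural_preorder G \<longrightarrow> \<beta> = \<alpha>}"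

definition generated_submonoid :: "('a, 'b) monoid_scheme \<Rightarrow> 'a set \<Rightarrow> 'a set"
  where "generated_submonoid G S = \<Inter>{H. submonoid H G \<and> S \<subseteq> H}"

end

theory Submission
  imports Defs
begin

text \<open>
  Let \<open>\<mu>(\<gamma>)\<close> be the largest number of endomorphisms of an object \<open>X\<close> with \<open>|X| = \<gamma>\<close>; it is finite because
  the fibre over \<open>\<gamma>\<close> and all Hom sets are. As \<open>End X \<times> End Y\<close> embeds into \<open>End (X \<oplus> Y)\<close> by block
  diagonal matrices, \<open>\<mu>(\<alpha>) \<mu>(\<beta>) \<le> \<mu>(\<alpha> + \<beta>)\<close>, and \<open>\<mu>(\<gamma>) = 1\<close> forces \<open>\<gamma> = 0\<close>. So
  \<open>\<alpha> = \<alpha> + \<gamma> + \<delta>\<close> implies \<open>\<gamma> = \<delta> = 0\<close>, which is antisymmetry, and in a sum of two nonzero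
  elements both summands have smaller \<open>\<mu>\<close>, so that splitting off nonminimal elements terminates.
\<close>

section \<open>Arrows of an additive category\<close>

lemma Hom_iff: "f \<in> Hom C X Y \<longleftrightarrow> f \<in> arrows C \<and> source C f = X \<and> target C f = Y"
  by (simp add: Hom_def)

section \<open>Composition rules and isomorphism of objects\<close>

context category
begin

declare source_in [simp] target_in [simp]

lemma ident_arrow [simp]:
  assumes "X \<in> objects C"
  shows "ident C X \<in> arrows C" "source C (ident C X) = X" "target C (ident C X) = X"
  using ident_in[OF assms] by (simp_all add: Hom_iff)

lemma compose_arrow [simp]:
  assumes "f \<in> arrows C" "g \<in> arrows C" "target C f = source C g"
  shows "g \<odot> f \<in> arrows C" "source C (g \<odot> f) = source C f" "target C (g \<odot> f) = target C g"
  using compose_in[of f "source C f" "target C f" g "target C g"] assms by (simp_all add: Hom_iff)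

lemma compose_assoc' [simp]:
  assumes "f \<in> arrows C" "g \<in> arrows C" "h \<in> arrows C"
    "target C f = source C g" "target C g = source C h"
  shows "h \<odot> g \<odot> f = h \<odot> (g \<odot> f)"
  using assms by (intro compose_assoc[of _ "source C f" "source C g" _ "source C h" _ "target C h"])
    (simp_all add: Hom_iff)

lemma ident_compose [simp]:
  assumes "f \<in> arrows C"
  shows "target C f = Y \<Longrightarrow> ident C Y \<odot> f = f" "source C f = X \<Longrightarrow> f \<odot> ident C X = f"
  using assms ident_left[of f "source C f" Y] ident_right[of f X "target C f"]
  by (simp_all add: Hom_iff)

text \<open>Composites are normalised to nest to the right, where \<open>g \<odot> f\<close> no
  longer occurs as a subterm; in this form the equation \<open>g \<odot> f = ident C X\<close> still
  applies.\<close>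

lemma compose_ident_assoc:
  assumes "g \<odot> f = ident C X" "f \<in> arrows C" "g \<in> arrows C" "target C f = source C g"
    "source C f = X" "t \<in> arrows C" "target C t = X"
  shows "g \<odot> (f \<odot> t) = t"
  using assms by (metis compose_assoc' ident_compose(1))

lemma isomorphicI:
  assumes "f \<in> Hom C X Y" "g \<in> Hom C Y X" "g \<odot> f = ident C X" "f \<odot> g = ident C Y"
  shows "isomorphic C X Y"
  using assms unfolding isomorphic_def isomorphism_def by (intro bexI[of _ f]) (auto simp: Hom_def)

lemma isomorphicE:
  assumes "isomorphic C X Y"
  obtains f g where "f \<in> Hom C X Y" "g \<in> Hom C Y X" "g \<odot> f = ident C X" "f \<odot> g = ident C Y"
  using assms unfolding isomorphic_def isomorphism_def by (auto simp: Hom_iff)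

lemma isomorphic_refl: "X \<in> objects C \<Longrightarrow> isomorphic C X X"
  by (rule isomorphicI[of "ident C X" _ _ "ident C X"]) (simp_all add: Hom_iff)

lemma isomorphic_sym: "isomorphic C X Y \<Longrightarrow> isomorphic C Y X"
  by (elim isomorphicE) (rule isomorphicI)

lemma isomorphic_trans:
  assumes "isomorphic C X Y" "isomorphic C Y Z"
  shows "isomorphic C X Z"
proof -
  obtain f g where fg: "f \<in> Hom C X Y" "g \<in> Hom C Y X" "g \<odot> f = ident C X" "f \<odot> g = ident C Y"
    using assms(1) by (rule isomorphicE)
  obtain f' g' where fg': "f' \<in> Hom C Y Z" "g' \<in> Hom C Z Y" "g' \<odot> f' = ident C Y"
    "f' \<odot> g' = ident C Z"
    using assms(2) by (rule isomorphicE)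
  show ?thesis
    using fg fg'
    by (intro isomorphicI[of "f' \<odot> f" _ _ "g \<odot> g'"]) (simp_all add: Hom_iff compose_ident_assoc)
qed

lemma iso_class_eq_iff:
  assumes "X \<in> objects C" "Y \<in> objects C"
  shows "iso_class C X = iso_class C Y \<longleftrightarrow> isomorphic C X Y"
  using assms isomorphic_refl isomorphic_sym isomorphic_trans unfolding iso_class_def by blast

text \<open>Conjugation by an isomorphism is injective, its inverse being conjugation the other way.
  Finiteness of the receiving set keeps its \<open>card\<close> from being the default value
  0.\<close>

lemma card_Hom_le_of_isomorphic:
  assumes "isomorphic C X Y" "finite (Hom C Y Y)"
  shows "card (Hom C X X) \<le> card (Hom C Y Y)"
proof -
  obtain f g where fg: "f \<in> Hom C X Y" "g \<in> Hom C Y X" "g \<odot> f = ident C X" "f \<odot> g = ident C Y"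
    using assms(1) by (rule isomorphicE)
  show ?thesis
  proof (rule card_inj_on_le[of "\<lambda>h. f \<odot> (h \<odot> g)"])
    show "inj_on (\<lambda>h. f \<odot> (h \<odot> g)) (Hom C X X)"
    proof (rule inj_on_inverseI)
      fix h
      assume "h \<in> Hom C X X"
      then show "g \<odot> (f \<odot> (h \<odot> g) \<odot> f) = h"
        using fg by (simp add: Hom_iff compose_ident_assoc)
    qed
    show "(\<lambda>h. f \<odot> (h \<odot> g)) ` Hom C X X \<subseteq> Hom C Y Y"
      using fg by (simp add: Hom_iff image_subset_iff)
  qed (fact assms(2))
qed

end

section \<open>Hom groups, zero arrows and zero objects\<close>

context additive_category
begin

lemma add_arrow [simp]:
  assumes "f \<in> arrows C" "g \<in> arrows C" "source C f = source C g" "target C f = target C g"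
  shows "f \<boxplus> g \<in> arrows C" "source C (f \<boxplus> g) = source C g" "target C (f \<boxplus> g) = target C g"
proof -
  interpret comm_group "Hom_group C (source C g) (target C g)"
    using assms by (simp add: Hom_comm_group)
  show "f \<boxplus> g \<in> arrows C" "source C (f \<boxplus> g) = source C g" "target C (f \<boxplus> g) = target C g"
    using m_closed[of f g] assms by (simp_all add: Hom_group_def Hom_iff)
qed

lemma zero_arrow [simp]:
  assumes "X \<in> objects C" "Y \<in> objects C"
  shows "arr_zero C X Y \<in> arrows C" "source C (arr_zero C X Y) = X"
    "target C (arr_zero C X Y) = Y"
proof -
  interpret comm_group "Hom_group C X Y"
    using assms by (simp add: Hom_comm_group)
  show "arr_zero C X Y \<in> arrows C" "source C (arr_zero C X Y) = X"
    "target C (arr_zero C X Y) = Y"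
    using one_closed by (simp_all add: Hom_group_def Hom_iff)
qed

lemma add_assoc:
  assumes "f \<in> arrows C" "g \<in> arrows C" "h \<in> arrows C" "source C f = source C g"
    "target C f = target C g" "source C g = source C h" "target C g = target C h"
  shows "f \<boxplus> g \<boxplus> h = f \<boxplus> (g \<boxplus> h)"
proof -
  interpret comm_group "Hom_group C (source C g) (target C g)"
    using assms by (simp add: Hom_comm_group)
  show ?thesis
    using m_assoc[of f g h] assms by (simp add: Hom_group_def Hom_iff)
qed

lemma add_commute:
  assumes "f \<in> arrows C" "g \<in> arrows C" "source C f = source C g" "target C f = target C g"
  shows "f \<boxplus> g = g \<boxplus> f"
proof -
  interpret comm_group "Hom_group C (source C g) (target C g)"
    using assms by (simp add: Hom_comm_group)
  show ?thesis
    using m_comm[of f g] assms by (simp add: Hom_group_def Hom_iff)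
qed

lemma zero_add [simp]:
  assumes "f \<in> arrows C" "source C f = X" "target C f = Y"
  shows "arr_zero C X Y \<boxplus> f = f" "f \<boxplus> arr_zero C X Y = f"
proof -
  interpret comm_group "Hom_group C X Y"
    using assms by (auto intro: Hom_comm_group)
  show "arr_zero C X Y \<boxplus> f = f" "f \<boxplus> arr_zero C X Y = f"
    using l_one[of f] r_one[of f] assms by (simp_all add: Hom_group_def Hom_iff)
qed

lemma eq_zero_if_add_self:
  assumes "f \<in> arrows C" "f \<boxplus> f = f"
  shows "f = arr_zero C (source C f) (target C f)"
proof -
  interpret comm_group "Hom_group C (source C f) (target C f)"
    using assms by (simp add: Hom_comm_group)
  show ?thesis
    using r_cancel_one[of f f] assms by (simp add: Hom_group_def Hom_iff)
qed

lemma add_compose [simp]: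
  assumes "f \<in> arrows C" "g \<in> arrows C" "g' \<in> arrows C" "source C g = target C f"
    "source C g' = target C f" "target C g = target C g'"
  shows "(g \<boxplus> g') \<odot> f = g \<odot> f \<boxplus> g' \<odot> f"
  using assms compose_add_left[of f "source C f" "target C f" g "target C g" g']
  by (simp add: Hom_iff)

lemma compose_add [simp]:
  assumes "f \<in> arrows C" "f' \<in> arrows C" "g \<in> arrows C" "target C f = source C g"
    "target C f' = source C g" "source C f = source C f'"
  shows "g \<odot> (f \<boxplus> f') = g \<odot> f \<boxplus> g \<odot> f'"
  using assms compose_add_right[of f "source C f" "target C f" f' g "target C g"]
  by (simp add: Hom_iff)

text \<open>By distributivity the composite equals its own double, and in a group only the neutral
  element does.\<close>

lemma compose_zero [simp]:
  assumes "X \<in> objects C" "f \<in> arrows C" "source C f = Y"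
  shows "f \<odot> arr_zero C X Y = arr_zero C X (target C f)"
proof -
  have "f \<odot> arr_zero C X Y \<boxplus> f \<odot> arr_zero C X Y = f \<odot> (arr_zero C X Y \<boxplus> arr_zero C X Y)"
    using assms by (subst compose_add) auto
  also have "\<dots> = f \<odot> arr_zero C X Y"
    using assms by (subst zero_add) auto
  finally show ?thesis
    using eq_zero_if_add_self[of "f \<odot> arr_zero C X Y"] assms by auto
qed

lemma zero_compose [simp]:
  assumes "Z \<in> objects C" "f \<in> arrows C" "target C f = Y"
  shows "arr_zero C Y Z \<odot> f = arr_zero C (source C f) Z"
proof -
  have "arr_zero C Y Z \<odot> f \<boxplus> arr_zero C Y Z \<odot> f = (arr_zero C Y Z \<boxplus> arr_zero C Y Z) \<odot> f"
    using assms by (subst add_compose) auto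
  also have "\<dots> = arr_zero C Y Z \<odot> f"
    using assms by (subst zero_add) auto
  finally show ?thesis
    using eq_zero_if_add_self[of "arr_zero C Y Z \<odot> f"] assms by auto
qed

text \<open>Trades the universal property for one equation: if the identity of \<open>X\<close> is
  zero, every arrow into or out of \<open>X\<close> is a composite with a zero arrow. Conversely,
  the identity and the zero arrow lie in a one-element set.\<close>

lemma zero_object_iff:
  "zero_object C X \<longleftrightarrow> X \<in> objects C \<and> ident C X = arr_zero C X X"
proof safe
  assume zero: "zero_object C X"
  then show X: "X \<in> objects C"
    by (simp add: zero_object_def)
  have "\<exists>!f. f \<in> Hom C X X"
    using zero X by (simp add: zero_object_def)
  moreover have "ident C X \<in> Hom C X X" "arr_zero C X X \<in> Hom C X X"
    using X by (simp_all add: Hom_iff)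
  ultimately show "ident C X = arr_zero C X X"
    by blast
next
  assume X: "X \<in> objects C" and eq: "ident C X = arr_zero C X X"
  have from_X: "f = arr_zero C X Y" if "f \<in> Hom C X Y" "Y \<in> objects C" for f Y
  proof -
    have "f \<odot> arr_zero C X X = arr_zero C X Y"
      using that X by (simp add: Hom_iff)
    then show ?thesis
      using that(1) by (simp add: Hom_iff flip: eq)
  qed
  have to_X: "f = arr_zero C Y X" if "f \<in> Hom C Y X" "Y \<in> objects C" for f Y
  proof -
    have "arr_zero C X X \<odot> f = arr_zero C Y X"
      using that X by (simp add: Hom_iff)
    then show ?thesis
      using that(1) by (simp add: Hom_iff flip: eq)
  qed
  have "arr_zero C X Y \<in> Hom C X Y" "arr_zero C Y X \<in> Hom C Y X" if "Y \<in> objects C" for Y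
    using X that by (simp_all add: Hom_iff)
  with from_X to_X X show "zero_object C X"
    unfolding zero_object_def by blast
qed

text \<open>Zero arrows between zero objects are mutually inverse, and vanishing of the identity
  passes along isomorphisms by conjugation; so the zero objects form a single isomorphism
  class.\<close>

lemma iso_class_zero:
  assumes "zero_object C X"
  shows "iso_class C X = iso_zero C"
proof -
  have X: "X \<in> objects C" "ident C X = arr_zero C X X"
    using assms by (simp_all add: zero_object_iff)
  have "zero_object C Y" if iso: "isomorphic C X Y" and Y: "Y \<in> objects C" for Y
  proof -
    obtain f g where fg: "f \<in> Hom C X Y" "g \<in> Hom C Y X" "g \<odot> f = ident C X" "f \<odot> g = ident C Y"
      using iso by (rule isomorphicE)
    have "f \<odot> (ident C X \<odot> g) = arr_zero C Y Y"
      unfolding X(2) using fg X(1) Y by (simp add: Hom_iff)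
    then show ?thesis
      using fg Y by (simp add: zero_object_iff Hom_iff)
  qed
  moreover have "isomorphic C X Y" if "zero_object C Y" for Y
    using X that
    by (intro isomorphicI[of "arr_zero C X Y" _ _ "arr_zero C Y X"])
      (simp_all add: zero_object_iff Hom_iff)
  ultimately show ?thesis
    by (auto simp: iso_class_def iso_zero_def zero_object_iff)
qed

end


section \<open>Direct sums\<close>

context additive_category
begin

text \<open>
  The simplifier nests composites to the right, so the four relations between injections and
  projections are also needed with a further arrow \<open>t\<close> in front.
\<close>

lemma biproduct_simps:
  assumes "biproduct C X Y S i\<^sub>1 i\<^sub>2 p\<^sub>1 p\<^sub>2"
  shows "X \<in> objects C" "Y \<in> objects C" "S \<in> objects C"
    "i\<^sub>1 \<in> arrows C" "i\<^sub>2 \<in> arrows C" "p\<^sub>1 \<in> arrows C" "p\<^sub>2 \<in> arrows C"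
    "source C i\<^sub>1 = X" "source C i\<^sub>2 = Y" "source C p\<^sub>1 = S" "source C p\<^sub>2 = S"
    "target C i\<^sub>1 = S" "target C i\<^sub>2 = S" "target C p\<^sub>1 = X" "target C p\<^sub>2 = Y"
    "p\<^sub>1 \<odot> i\<^sub>1 = ident C X" "p\<^sub>2 \<odot> i\<^sub>2 = ident C Y"
    "p\<^sub>1 \<odot> i\<^sub>2 = arr_zero C Y X" "p\<^sub>2 \<odot> i\<^sub>1 = arr_zero C X Y"
    "i\<^sub>1 \<odot> p\<^sub>1 \<boxplus> i\<^sub>2 \<odot> p\<^sub>2 = ident C S"
    "\<And>t. t \<in> arrows C \<Longrightarrow> target C t = X \<Longrightarrow> p\<^sub>1 \<odot> (i\<^sub>1 \<odot> t) = t"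
    "\<And>t. t \<in> arrows C \<Longrightarrow> target C t = Y \<Longrightarrow> p\<^sub>2 \<odot> (i\<^sub>2 \<odot> t) = t"
    "\<And>t. t \<in> arrows C \<Longrightarrow> target C t = Y \<Longrightarrow> p\<^sub>1 \<odot> (i\<^sub>2 \<odot> t) = arr_zero C (source C t) X"
    "\<And>t. t \<in> arrows C \<Longrightarrow> target C t = X \<Longrightarrow> p\<^sub>2 \<odot> (i\<^sub>1 \<odot> t) = arr_zero C (source C t) Y"
proof -
  note bip = assms[unfolded biproduct_def Hom_iff]
  show "X \<in> objects C" "Y \<in> objects C" "S \<in> objects C"
    "i\<^sub>1 \<in> arrows C" "i\<^sub>2 \<in> arrows C" "p\<^sub>1 \<in> arrows C" "p\<^sub>2 \<in> arrows C"
    "source C i\<^sub>1 = X" "source C i\<^sub>2 = Y" "source C p\<^sub>1 = S" "source C p\<^sub>2 = S"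
    "target C i\<^sub>1 = S" "target C i\<^sub>2 = S" "target C p\<^sub>1 = X" "target C p\<^sub>2 = Y"
    "p\<^sub>1 \<odot> i\<^sub>1 = ident C X" "p\<^sub>2 \<odot> i\<^sub>2 = ident C Y"
    "p\<^sub>1 \<odot> i\<^sub>2 = arr_zero C Y X" "p\<^sub>2 \<odot> i\<^sub>1 = arr_zero C X Y"
    "i\<^sub>1 \<odot> p\<^sub>1 \<boxplus> i\<^sub>2 \<odot> p\<^sub>2 = ident C S"
    using bip by simp_all
  fix t assume t: "t \<in> arrows C"
  show "p\<^sub>1 \<odot> (i\<^sub>1 \<odot> t) = t" if "target C t = X"
    using bip t that compose_assoc'[of t i\<^sub>1 p\<^sub>1] by simp
  show "p\<^sub>2 \<odot> (i\<^sub>2 \<odot> t) = t" if "target C t = Y"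
    using bip t that compose_assoc'[of t i\<^sub>2 p\<^sub>2] by simp
  show "p\<^sub>1 \<odot> (i\<^sub>2 \<odot> t) = arr_zero C (source C t) X" if "target C t = Y"
    using bip t that compose_assoc'[of t i\<^sub>2 p\<^sub>1] by simp
  show "p\<^sub>2 \<odot> (i\<^sub>1 \<odot> t) = arr_zero C (source C t) Y" if "target C t = X"
    using bip t that compose_assoc'[of t i\<^sub>1 p\<^sub>2] by simp
qed

text \<open>Comes from composing the decomposition of \<open>ident C S\<close> with
  \<open>t\<close>; it recovers an arrow into \<open>S\<close> from its two components.\<close>

lemma biproduct_decompose_left:
  assumes b: "biproduct C X Y S i\<^sub>1 i\<^sub>2 p\<^sub>1 p\<^sub>2" and t: "t \<in> arrows C" "target C t = S"
  shows "i\<^sub>1 \<odot> (p\<^sub>1 \<odot> t) \<boxplus> i\<^sub>2 \<odot> (p\<^sub>2 \<odot> t) = t"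
proof -
  note [simp] = biproduct_simps[OF b]
  \<comment> \<open>One composite is evaluated twice: here with distributivity switched off, so that
    the sum becomes the identity, and then with the identity rule switched off, so that the sum is
    distributed.\<close>
  have "(i\<^sub>1 \<odot> p\<^sub>1 \<boxplus> i\<^sub>2 \<odot> p\<^sub>2) \<odot> t = t"
    using t by (simp del: add_compose)
  then show ?thesis
    using t by (simp del: biproduct_simps(20)[OF b])
qed

lemma biproduct_decompose_right:
  assumes b: "biproduct C X Y S i\<^sub>1 i\<^sub>2 p\<^sub>1 p\<^sub>2" and t: "t \<in> arrows C" "source C t = S"
  shows "t \<odot> (i\<^sub>1 \<odot> p\<^sub>1) \<boxplus> t \<odot> (i\<^sub>2 \<odot> p\<^sub>2) = t"
proof -
  note [simp] = biproduct_simps[OF b]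
  have "t \<odot> (i\<^sub>1 \<odot> p\<^sub>1 \<boxplus> i\<^sub>2 \<odot> p\<^sub>2) = t"
    using t by (simp del: compose_add)
  then show ?thesis
    using t by (simp del: biproduct_simps(20)[OF b])
qed

section \<open>Direct sums as a relation between objects, up to isomorphism\<close>

lemma biproduct_swap:
  assumes "biproduct C X Y S i\<^sub>1 i\<^sub>2 p\<^sub>1 p\<^sub>2"
  shows "biproduct C Y X S i\<^sub>2 i\<^sub>1 p\<^sub>2 p\<^sub>1"
proof -
  have "i\<^sub>2 \<odot> p\<^sub>2 \<boxplus> i\<^sub>1 \<odot> p\<^sub>1 = i\<^sub>1 \<odot> p\<^sub>1 \<boxplus> i\<^sub>2 \<odot> p\<^sub>2"
    using biproduct_simps[OF assms] by (intro add_commute) simp_all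
  then show ?thesis
    using biproduct_simps[OF assms] by (simp add: biproduct_def Hom_iff)
qed

lemma direct_sum_commute: "direct_sum C X Y S \<Longrightarrow> direct_sum C Y X S"
  unfolding direct_sum_def using biproduct_swap by blast

lemma direct_sum_objects:
  "direct_sum C X Y S \<Longrightarrow> X \<in> objects C \<and> Y \<in> objects C \<and> S \<in> objects C"
  by (auto simp: direct_sum_def biproduct_def)

lemma direct_sum_zero:
  assumes X: "X \<in> objects C" and Z: "zero_object C Z"
  shows "direct_sum C X Z X"
proof -
  have "biproduct C X Z X (ident C X) (arr_zero C Z X) (ident C X) (arr_zero C X Z)"
    using assms by (auto simp: biproduct_def Hom_iff zero_object_iff)
  then show ?thesis
    unfolding direct_sum_def by blast
qed

text \<open>The block diagonal arrows with entries \<open>f\<close>, \<open>g\<close> and with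
  entries \<open>f'\<close>, \<open>g'\<close> are mutually inverse.\<close>

lemma direct_sum_isomorphic:
  assumes "direct_sum C X Y S" "direct_sum C X' Y' S'" "isomorphic C X X'" "isomorphic C Y Y'"
  shows "isomorphic C S S'"
proof -
  obtain i\<^sub>1 i\<^sub>2 p\<^sub>1 p\<^sub>2 where b: "biproduct C X Y S i\<^sub>1 i\<^sub>2 p\<^sub>1 p\<^sub>2"
    using assms(1) by (auto simp: direct_sum_def)
  obtain j\<^sub>1 j\<^sub>2 q\<^sub>1 q\<^sub>2 where b': "biproduct C X' Y' S' j\<^sub>1 j\<^sub>2 q\<^sub>1 q\<^sub>2"
    using assms(2) by (auto simp: direct_sum_def)
  obtain f f' where f: "f \<in> Hom C X X'" "f' \<in> Hom C X' X" "f' \<odot> f = ident C X"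
    "f \<odot> f' = ident C X'"
    using assms(3) by (rule isomorphicE)
  obtain g g' where g: "g \<in> Hom C Y Y'" "g' \<in> Hom C Y' Y" "g' \<odot> g = ident C Y"
    "g \<odot> g' = ident C Y'"
    using assms(4) by (rule isomorphicE)
  show ?thesis
    using f g biproduct_simps[OF b] biproduct_simps[OF b']
    by (intro isomorphicI[of "j\<^sub>1 \<odot> (f \<odot> p\<^sub>1) \<boxplus> j\<^sub>2 \<odot> (g \<odot> p\<^sub>2)" _ _
          "i\<^sub>1 \<odot> (f' \<odot> q\<^sub>1) \<boxplus> i\<^sub>2 \<odot> (g' \<odot> q\<^sub>2)"])
      (simp_all add: Hom_iff compose_ident_assoc)
qed

text \<open>Injections are followed by the isomorphism, projections preceded by its inverse. With
  uniqueness, this makes the direct sums of two given objects a full isomorphism class.\<close>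

lemma direct_sum_transport:
  assumes "direct_sum C X Y S" "isomorphic C S S'"
  shows "direct_sum C X Y S'"
proof -
  obtain i\<^sub>1 i\<^sub>2 p\<^sub>1 p\<^sub>2 where b: "biproduct C X Y S i\<^sub>1 i\<^sub>2 p\<^sub>1 p\<^sub>2"
    using assms(1) by (auto simp: direct_sum_def)
  obtain f g where fg: "f \<in> Hom C S S'" "g \<in> Hom C S' S" "g \<odot> f = ident C S"
    "f \<odot> g = ident C S'"
    using assms(2) by (rule isomorphicE)
  have "S' \<in> objects C"
    using fg(1) by (auto simp: Hom_iff)
  \<comment> \<open>The condition that the new injections and projections decompose the identity of
    \<open>S'\<close>, factored so that the decomposition of \<open>g\<close> applies.\<close>
  moreover have "f \<odot> (i\<^sub>1 \<odot> (p\<^sub>1 \<odot> g) \<boxplus> i\<^sub>2 \<odot> (p\<^sub>2 \<odot> g)) = f \<odot> g"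
    using fg by (subst biproduct_decompose_left[OF b]) (auto simp: Hom_iff)
  ultimately have "biproduct C X Y S' (f \<odot> i\<^sub>1) (f \<odot> i\<^sub>2) (p\<^sub>1 \<odot> g) (p\<^sub>2 \<odot> g)"
    using fg biproduct_simps[OF b] by (simp add: biproduct_def Hom_iff compose_ident_assoc)
  then show ?thesis
    unfolding direct_sum_def by blast
qed

text \<open>The complement \<open>U\<close> of \<open>X\<close> enters \<open>T\<close> by sending
  its summand \<open>Y\<close> through \<open>S\<close> and its summand \<open>Z\<close>
  directly.\<close>

lemma direct_sum_assoc:
  assumes "direct_sum C X Y S" "direct_sum C S Z T" "direct_sum C Y Z U"
  shows "direct_sum C X U T"
proof -
  obtain i\<^sub>1 i\<^sub>2 p\<^sub>1 p\<^sub>2 where b: "biproduct C X Y S i\<^sub>1 i\<^sub>2 p\<^sub>1 p\<^sub>2"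
    using assms(1) by (auto simp: direct_sum_def)
  obtain a\<^sub>1 a\<^sub>2 b\<^sub>1 b\<^sub>2 where b': "biproduct C S Z T a\<^sub>1 a\<^sub>2 b\<^sub>1 b\<^sub>2"
    using assms(2) by (auto simp: direct_sum_def)
  obtain j\<^sub>1 j\<^sub>2 q\<^sub>1 q\<^sub>2 where b'': "biproduct C Y Z U j\<^sub>1 j\<^sub>2 q\<^sub>1 q\<^sub>2"
    using assms(3) by (auto simp: direct_sum_def)
  note simps = biproduct_simps[OF b] biproduct_simps[OF b'] biproduct_simps[OF b'']
  \<comment> \<open>The left-hand side is what remains of the required decomposition of
    \<open>ident C T\<close> after the relations inside \<open>U\<close> are applied; regrouping
    exposes the decomposition of \<open>b\<^sub>1\<close>.\<close>
  have "a\<^sub>1 \<odot> (i\<^sub>1 \<odot> (p\<^sub>1 \<odot> b\<^sub>1)) \<boxplus> (a\<^sub>1 \<odot> (i\<^sub>2 \<odot> (p\<^sub>2 \<odot> b\<^sub>1)) \<boxplus> a\<^sub>2 \<odot> b\<^sub>2)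
      = a\<^sub>1 \<odot> (i\<^sub>1 \<odot> (p\<^sub>1 \<odot> b\<^sub>1) \<boxplus> i\<^sub>2 \<odot> (p\<^sub>2 \<odot> b\<^sub>1)) \<boxplus> a\<^sub>2 \<odot> b\<^sub>2"
    using simps by (simp add: add_assoc)
  also have "\<dots> = ident C T"
    using simps by (subst biproduct_decompose_left[OF b]) auto
  finally have "biproduct C X U T (a\<^sub>1 \<odot> i\<^sub>1) (a\<^sub>1 \<odot> (i\<^sub>2 \<odot> q\<^sub>1) \<boxplus> a\<^sub>2 \<odot> q\<^sub>2)
      (p\<^sub>1 \<odot> b\<^sub>1) (j\<^sub>1 \<odot> (p\<^sub>2 \<odot> b\<^sub>1) \<boxplus> j\<^sub>2 \<odot> b\<^sub>2)"
    using simps by (simp add: biproduct_def Hom_iff)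
  then show ?thesis
    unfolding direct_sum_def by blast
qed

lemma card_Hom_direct_sum:
  assumes "direct_sum C X Y S" "finite (Hom C S S)"
  shows "card (Hom C X X) * card (Hom C Y Y) \<le> card (Hom C S S)"
proof -
  obtain i\<^sub>1 i\<^sub>2 p\<^sub>1 p\<^sub>2 where b: "biproduct C X Y S i\<^sub>1 i\<^sub>2 p\<^sub>1 p\<^sub>2"
    using assms(1) by (auto simp: direct_sum_def)
  let ?d = "\<lambda>(f, g). i\<^sub>1 \<odot> (f \<odot> p\<^sub>1) \<boxplus> i\<^sub>2 \<odot> (g \<odot> p\<^sub>2)"
  \<comment> \<open>Compressing a block diagonal endomorphism to a summand returns its block, which
    provides a left inverse of \<open>?d\<close>.\<close>
  have "p\<^sub>1 \<odot> (?d (f, g) \<odot> i\<^sub>1) = f" "p\<^sub>2 \<odot> (?d (f, g) \<odot> i\<^sub>2) = g" "?d (f, g) \<in> Hom C S S"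
    if "f \<in> Hom C X X" "g \<in> Hom C Y Y" for f g
    using that biproduct_simps[OF b] by (simp_all add: Hom_iff)
  then have left_inverse: "(p\<^sub>1 \<odot> (?d h \<odot> i\<^sub>1), p\<^sub>2 \<odot> (?d h \<odot> i\<^sub>2)) = h" and closed: "?d h \<in> Hom C S S"
    if "h \<in> Hom C X X \<times> Hom C Y Y" for h
    using that by (cases h; simp)+
  have "inj_on ?d (Hom C X X \<times> Hom C Y Y)"
    by (rule inj_on_inverseI) (rule left_inverse)
  moreover have "?d ` (Hom C X X \<times> Hom C Y Y) \<subseteq> Hom C S S"
    using closed by (rule image_subsetI)
  ultimately show ?thesis
    using card_inj_on_le[of ?d "Hom C X X \<times> Hom C Y Y" "Hom C S S"] assms(2)
    by (simp add: card_cartesian_product)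
qed

text \<open>Uniqueness puts the sums of all representatives into the class of \<open>S\<close>, and
  transport shows that each object of that class is a sum of \<open>X\<close> and \<open>Y\<close>
  themselves.\<close>

lemma iso_add_iso_class:
  assumes "direct_sum C X Y S"
  shows "iso_add C (iso_class C X) (iso_class C Y) = iso_class C S"
proof -
  have "X \<in> objects C" "Y \<in> objects C"
    using direct_sum_objects[OF assms] by simp_all
  then show ?thesis
    using assms direct_sum_isomorphic[OF assms] direct_sum_transport[OF assms] direct_sum_objects
      isomorphic_refl
    unfolding iso_add_def iso_class_def by blast
qed

end

section \<open>Extensions and the Grothendieck monoid\<close>

context additive_category
begin

lemma cokernel_arrows:
  assumes "is_cokernel C p i"
  shows "i \<in> arrows C" "p \<in> arrows C" "target C i = source C p"
    "p \<odot> i = arr_zero C (source C i) (target C p)"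
  using assms by (simp_all add: is_cokernel_def)

lemma cokernel_factor:
  assumes "is_cokernel C p i" "f \<in> Hom C (source C p) T"
    "f \<odot> i = arr_zero C (source C i) T"
  obtains g where "g \<in> Hom C (target C p) T" "g \<odot> p = f"
proof -
  have "T \<in> objects C"
    using assms(2) target_in[of f] by (simp add: Hom_iff)
  then show ?thesis
    using assms that unfolding is_cokernel_def by (metis (no_types, lifting))
qed

text \<open>\<open>g \<odot> p\<close> annihilates \<open>i\<close>, so the uniqueness clause of the
  universal property applies to it.\<close>

lemma cokernel_epi:
  assumes coker: "is_cokernel C p i" and g: "g \<in> Hom C (target C p) T" "g' \<in> Hom C (target C p) T"
    and eq: "g \<odot> p = g' \<odot> p"
  shows "g = g'"
proof -
  note [simp] = cokernel_arrows[OF coker]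
  have T: "T \<in> objects C"
    using g(1) target_in[of g] by (simp add: Hom_iff)
  have "g \<odot> p \<in> Hom C (target C i) T" "g \<odot> p \<odot> i = arr_zero C (source C i) T"
    using g T by (simp_all add: Hom_iff)
  then have "\<exists>!h. h \<in> Hom C (target C p) T \<and> h \<odot> p = g \<odot> p"
    using coker T unfolding is_cokernel_def by blast
  then show ?thesis
    using g eq by metis
qed

text \<open>The long arrow is the sum of \<open>p\<close> and the identity of \<open>Z\<close>. An
  arrow out of \<open>S\<close> is a pair of arrows on the summands; annihilating
  \<open>i\<^sub>1 \<odot> i\<close> makes the first factor through \<open>p\<close>, while the
  second is carried over unchanged.\<close>

lemma cokernel_direct_sum:
  assumes coker: "is_cokernel C p i" and b: "biproduct C (source C p) Z S i\<^sub>1 i\<^sub>2 p\<^sub>1 p\<^sub>2"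
    and b': "biproduct C (target C p) Z T j\<^sub>1 j\<^sub>2 q\<^sub>1 q\<^sub>2"
  shows "is_cokernel C (j\<^sub>1 \<odot> (p \<odot> p\<^sub>1) \<boxplus> j\<^sub>2 \<odot> p\<^sub>2) (i\<^sub>1 \<odot> i)"
proof -
  let ?r = "j\<^sub>1 \<odot> (p \<odot> p\<^sub>1) \<boxplus> j\<^sub>2 \<odot> p\<^sub>2"
  note simps = cokernel_arrows[OF coker] biproduct_simps[OF b] biproduct_simps[OF b']
  have unique: "\<exists>!g. g \<in> Hom C T U \<and> g \<odot> ?r = f"
    if f: "f \<in> Hom C S U" and zero: "f \<odot> (i\<^sub>1 \<odot> i) = arr_zero C (source C i) U" for f U
  proof -
    have "f \<odot> i\<^sub>1 \<in> Hom C (source C p) U" "f \<odot> i\<^sub>1 \<odot> i = arr_zero C (source C i) U"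
      using f zero simps by (simp_all add: Hom_iff)
    then obtain g where g: "g \<in> Hom C (target C p) U" "g \<odot> p = f \<odot> i\<^sub>1"
      using cokernel_factor[OF coker] by blast
    \<comment> \<open>The factorisation of \<open>f \<odot> i\<^sub>1\<close> in the form that
      right-nested composites need.\<close>
    have gp: "g \<odot> (p \<odot> t) = f \<odot> (i\<^sub>1 \<odot> t)" if "t \<in> arrows C" "target C t = source C p" for t
    proof -
      have "g \<odot> p \<odot> t = f \<odot> i\<^sub>1 \<odot> t"
        using g(2) by simp
      then show ?thesis
        using f g(1) that simps by (simp add: Hom_iff)
    qed
    \<comment> \<open>The pair with component \<open>g\<close> on \<open>target C p\<close> and
      \<open>f \<odot> i\<^sub>2\<close> on \<open>Z\<close>.\<close>
    let ?h = "g \<odot> q\<^sub>1 \<boxplus> f \<odot> (i\<^sub>2 \<odot> q\<^sub>2)"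
    show ?thesis
    proof (intro ex1I[of _ ?h] conjI)
      show "?h \<in> Hom C T U"
        using f g simps by (simp add: Hom_iff)
      have "?h \<odot> ?r = f \<odot> (i\<^sub>1 \<odot> p\<^sub>1) \<boxplus> f \<odot> (i\<^sub>2 \<odot> p\<^sub>2)"
        using f g gp simps by (simp add: Hom_iff)
      also have "\<dots> = f"
        using f by (intro biproduct_decompose_right[OF b]) (simp_all add: Hom_iff)
      finally show "?h \<odot> ?r = f" .
      fix h
      assume h: "h \<in> Hom C T U \<and> h \<odot> ?r = f"
      \<comment> \<open>Restricting to \<open>i\<^sub>1\<close> and \<open>i\<^sub>2\<close>
        determines \<open>h \<odot> j\<^sub>1\<close>, as \<open>p\<close> can be cancelled, and
        \<open>h \<odot> j\<^sub>2\<close>; together they determine \<open>h\<close>.\<close>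
      have "h \<odot> ?r \<odot> i\<^sub>1 = h \<odot> (j\<^sub>1 \<odot> p)" "h \<odot> ?r \<odot> i\<^sub>2 = h \<odot> j\<^sub>2"
        using conjunct1[OF h] simps by (simp_all add: Hom_iff)
      then have fi: "f \<odot> i\<^sub>1 = h \<odot> (j\<^sub>1 \<odot> p)" "f \<odot> i\<^sub>2 = h \<odot> j\<^sub>2"
        unfolding conjunct2[OF h] .
      have "h \<odot> j\<^sub>1 \<in> Hom C (target C p) U" "h \<odot> j\<^sub>1 \<odot> p = g \<odot> p"
        using g(2) conjunct1[OF h] fi simps by (simp_all add: Hom_iff)
      then have "h \<odot> j\<^sub>1 = g"
        by (rule cokernel_epi[OF coker _ g(1)])
      then have "h \<odot> j\<^sub>1 \<odot> q\<^sub>1 \<boxplus> h \<odot> j\<^sub>2 \<odot> q\<^sub>2 = g \<odot> q\<^sub>1 \<boxplus> f \<odot> i\<^sub>2 \<odot> q\<^sub>2"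
        using fi(2) by (simp only:)
      moreover have "h \<odot> j\<^sub>1 \<odot> q\<^sub>1 \<boxplus> h \<odot> j\<^sub>2 \<odot> q\<^sub>2 = h \<odot> (j\<^sub>1 \<odot> q\<^sub>1) \<boxplus> h \<odot> (j\<^sub>2 \<odot> q\<^sub>2)"
        using conjunct1[OF h] simps by (simp add: Hom_iff)
      moreover have "\<dots> = h"
        using conjunct1[OF h] by (intro biproduct_decompose_right[OF b']) (simp_all add: Hom_iff)
      moreover have "f \<odot> i\<^sub>2 \<odot> q\<^sub>2 = f \<odot> (i\<^sub>2 \<odot> q\<^sub>2)"
        using f simps by (simp add: Hom_iff)
      ultimately show "h = ?h"
        by (simp only:)
    qed
  qed
  have "source C i \<in> objects C"
    using simps by simp
  then have "i\<^sub>1 \<odot> i \<in> arrows C" "?r \<in> arrows C" "target C (i\<^sub>1 \<odot> i) = S" "source C ?r = S"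
    "source C (i\<^sub>1 \<odot> i) = source C i" "target C ?r = T"
    "?r \<odot> (i\<^sub>1 \<odot> i) = arr_zero C (source C i) T"
    using simps by simp_all
  then show ?thesis
    unfolding is_cokernel_def using unique by (simp only:) blast
qed

end

section \<open>Adding a fixed object to a short exact sequence\<close>

context exact_category
begin

text \<open>Two cokernels of \<open>i\<close> differ by an isomorphism \<open>c\<close>, so the
  triple of two identities and \<open>c\<close> carries one sequence to the other. This allows
  prescribing the cokernel when a mono is only known to be admissible.\<close>

lemma short_exact_cokernel_replace:
  assumes se: "(i, q) \<in> short_exact C" and coker: "is_cokernel C r i"
  shows "(i, r) \<in> short_exact C"
proof -
  note coker' = short_exact_cokernel[OF se]
  note simps = cokernel_arrows(1,2,4)[OF coker] cokernel_arrows(2,4)[OF coker']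
    cokernel_arrows(3)[OF coker, symmetric] cokernel_arrows(3)[OF coker', symmetric]
  obtain c where c: "c \<in> Hom C (target C q) (target C r)" "c \<odot> q = r"
    using cokernel_factor[OF coker', of r "target C r"] simps by (auto simp: Hom_def)
  obtain d where d: "d \<in> Hom C (target C r) (target C q)" "d \<odot> r = q"
    using cokernel_factor[OF coker, of q "target C q"] simps by (auto simp: Hom_def)
  have objs: "target C q \<in> objects C" "target C r \<in> objects C"
    using simps by simp_all
  \<comment> \<open>\<open>c\<close> and \<open>d\<close> are mutually inverse: each of their
    composites agrees with an identity after precomposition with a cokernel, which cancels.\<close>
  have "d \<odot> c \<in> Hom C (target C q) (target C q)" "d \<odot> c \<odot> q = ident C (target C q) \<odot> q"
    using c d simps by (simp_all add: Hom_iff)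
  then have "d \<odot> c = ident C (target C q)"
    by (rule cokernel_epi[OF coker' _ ident_in[OF objs(1)]])
  moreover have "c \<odot> d \<in> Hom C (target C r) (target C r)"
    "c \<odot> d \<odot> r = ident C (target C r) \<odot> r"
    using c d simps by (simp_all add: Hom_iff)
  then have "c \<odot> d = ident C (target C r)"
    by (rule cokernel_epi[OF coker _ ident_in[OF objs(2)]])
  ultimately have "isomorphism C c"
    using c(1) d(1) unfolding isomorphism_def by (auto simp: Hom_def)
  moreover have "isomorphism C (ident C X)" if "X \<in> objects C" for X
    unfolding isomorphism_def using that
    by (intro conjI bexI[of _ "ident C X"]) (simp_all add: Hom_iff)
  moreover have "source C i \<in> objects C" "target C i \<in> objects C"
    using simps(1) by simp_all
  ultimately show ?thesis
    using c simps
    by (intro short_exact_iso[OF se, of "ident C (source C i)" "ident C (target C i)" c])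
      (simp_all add: Hom_iff)
qed

text \<open>The identity of \<open>Z\<close> is added to the middle and right terms of the sequence
  while \<open>N\<close> stays fixed. This makes the relation on classes compatible with
  addition.\<close>

lemma Ext1_direct_sum:
  assumes X: "X \<in> objects C" "iso_class C X \<in> Ext1 C M N"
    and sums: "direct_sum C X Z S" "direct_sum C M Z T"
  shows "iso_class C S \<in> Ext1 C T N"
proof -
  \<comment> \<open>Membership in \<open>Ext1\<close> only yields a sequence through some
    \<open>X'\<close> isomorphic to \<open>X\<close>, so the argument is run for a sum
    \<open>S'\<close> of \<open>X'\<close> and \<open>Z\<close>, which is isomorphic to
    \<open>S\<close>.\<close>
  obtain X' i p where X': "X' \<in> objects C" "iso_class C X = iso_class C X'"
    and se: "(i, p) \<in> short_exact C" "i \<in> Hom C N X'" "p \<in> Hom C X' M"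
    using X(2) unfolding Ext1_def by blast
  have Z: "Z \<in> objects C" and S: "S \<in> objects C"
    using direct_sum_objects[OF sums(1)] by simp_all
  obtain S' where S': "direct_sum C X' Z S'"
    using ex_direct_sum X'(1) Z by blast
  have S'_obj: "S' \<in> objects C"
    using direct_sum_objects[OF S'] by simp
  have "isomorphic C S S'"
    using direct_sum_isomorphic[OF sums(1) S'] X X' Z isomorphic_refl iso_class_eq_iff by blast
  then have class_S: "iso_class C S = iso_class C S'"
    using S S'_obj by (simp add: iso_class_eq_iff)
  obtain i\<^sub>1 i\<^sub>2 p\<^sub>1 p\<^sub>2 where b: "biproduct C X' Z S' i\<^sub>1 i\<^sub>2 p\<^sub>1 p\<^sub>2"
    using S' by (auto simp: direct_sum_def)
  obtain j\<^sub>1 j\<^sub>2 q\<^sub>1 q\<^sub>2 where b': "biproduct C M Z T j\<^sub>1 j\<^sub>2 q\<^sub>1 q\<^sub>2"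
    using sums(2) by (auto simp: direct_sum_def)
  note simps = biproduct_simps[OF b] biproduct_simps[OF b']
  have "admissible_mono C i" "admissible_mono C i\<^sub>1"
    using se(1) short_exact_split[OF b] unfolding admissible_mono_def by blast+
  then have "admissible_mono C (i\<^sub>1 \<odot> i)"
    using se simps by (intro admissible_mono_compose) (simp_all add: Hom_iff)
  then obtain q where q: "(i\<^sub>1 \<odot> i, q) \<in> short_exact C"
    by (auto simp: admissible_mono_def)
  \<comment> \<open>a composite of admissible monos is exact with some cokernel, hence also with \<open>p \<oplus> 1\<close>\<close>
  have "is_cokernel C (j\<^sub>1 \<odot> (p \<odot> p\<^sub>1) \<boxplus> j\<^sub>2 \<odot> p\<^sub>2) (i\<^sub>1 \<odot> i)"
    using se b b' by (intro cokernel_direct_sum[OF short_exact_cokernel]) (simp_all add: Hom_iff)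
  then have "(i\<^sub>1 \<odot> i, j\<^sub>1 \<odot> (p \<odot> p\<^sub>1) \<boxplus> j\<^sub>2 \<odot> p\<^sub>2) \<in> short_exact C"
    using q by (rule short_exact_cokernel_replace[rotated])
  moreover have "i\<^sub>1 \<odot> i \<in> Hom C N S'" "j\<^sub>1 \<odot> (p \<odot> p\<^sub>1) \<boxplus> j\<^sub>2 \<odot> p\<^sub>2 \<in> Hom C S' T"
    using se simps by (simp_all add: Hom_iff)
  ultimately show ?thesis
    unfolding Ext1_def class_S using S'_obj by blast
qed

text \<open>The split sequence obtained by viewing \<open>X\<close> as the direct sum of
  \<open>Z\<close> and \<open>X\<close>.\<close>

lemma iso_class_in_Ext1_zero:
  assumes "X \<in> objects C" "zero_object C Z"
  shows "iso_class C X \<in> Ext1 C X Z"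
proof -
  obtain i\<^sub>1 i\<^sub>2 p\<^sub>1 p\<^sub>2 where b: "biproduct C Z X X i\<^sub>1 i\<^sub>2 p\<^sub>1 p\<^sub>2"
    using direct_sum_commute[OF direct_sum_zero[OF assms]] by (auto simp: direct_sum_def)
  then have "i\<^sub>1 \<in> Hom C Z X" "p\<^sub>2 \<in> Hom C X X"
    by (simp_all add: biproduct_def)
  then show ?thesis
    using short_exact_split[OF b] assms(1) unfolding Ext1_def by blast
qed

section \<open>The congruence and the monoid structure\<close>

lemma equiv_grothendieck_rel: "equiv (Iso C) (grothendieck_rel C)"
proof -
  let ?r = "{(a, b). \<exists>M \<in> objects C. \<exists>N \<in> objects C. a \<in> Ext1 C M N \<and> b \<in> Ext1 C M N}"
  obtain Z where Z: "zero_object C Z"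
    using ex_zero_object by blast
  have sub: "?r \<subseteq> Iso C \<times> Iso C"
    unfolding Ext1_def Iso_def by blast
  \<comment> \<open>\<open>trancl\<close> adds no diagonal, so reflexivity has to come from a single
    step: every class is the middle term of some sequence.\<close>
  have "(a, a) \<in> ?r" if "a \<in> Iso C" for a
    using that iso_class_in_Ext1_zero[OF _ Z] Z unfolding Iso_def zero_object_def by blast
  moreover have "sym ?r"
    unfolding sym_def by blast
  moreover have "?r\<^sup>+ \<subseteq> Iso C \<times> Iso C"
    using sub by (rule trancl_subset_Sigma)
  ultimately show ?thesis
    unfolding grothendieck_rel_def
    by (intro equivI refl_onI sym_trancl trans_trancl r_into_trancl)
qed

lemma iso_class_in_Iso: "X \<in> objects C \<Longrightarrow> iso_class C X \<in> Iso C"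
  by (simp add: Iso_def)

text \<open>Two middle terms over the same \<open>M\<close> and \<open>N\<close> acquire, on adding
  \<open>Z\<close>, the common end terms \<open>T\<close> and \<open>N\<close>. A chain of such
  steps is translated one step at a time.\<close>

lemma grothendieck_rel_add_right:
  assumes "(a, b) \<in> grothendieck_rel C" "c \<in> Iso C"
  shows "(iso_add C a c, iso_add C b c) \<in> grothendieck_rel C"
proof -
  let ?r = "{(a, b). \<exists>M \<in> objects C. \<exists>N \<in> objects C. a \<in> Ext1 C M N \<and> b \<in> Ext1 C M N}"
  have add_c: "(iso_add C a c, iso_add C b c) \<in> ?r" if ab: "(a, b) \<in> ?r" for a b
  proof -
    obtain M N where MN: "M \<in> objects C" "N \<in> objects C" "a \<in> Ext1 C M N" "b \<in> Ext1 C M N"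
      using ab by blast
    obtain X Y Z where XYZ: "X \<in> objects C" "Y \<in> objects C" "Z \<in> objects C"
      "a = iso_class C X" "b = iso_class C Y" "c = iso_class C Z"
      using MN assms(2) unfolding Ext1_def Iso_def by blast
    obtain S S' T where sums: "direct_sum C X Z S" "direct_sum C Y Z S'" "direct_sum C M Z T"
      using XYZ MN ex_direct_sum by meson
    have "iso_class C S \<in> Ext1 C T N" "iso_class C S' \<in> Ext1 C T N"
      using Ext1_direct_sum[OF XYZ(1) _ sums(1,3)] Ext1_direct_sum[OF XYZ(2) _ sums(2,3)] MN(3,4)
      unfolding XYZ(4,5) by blast+
    then have "iso_add C a c \<in> Ext1 C T N" "iso_add C b c \<in> Ext1 C T N"
      unfolding XYZ(4-6) iso_add_iso_class[OF sums(1)] iso_add_iso_class[OF sums(2)] .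
    then show ?thesis
      using MN direct_sum_objects[OF sums(3)] by blast
  qed
  have "(a, b) \<in> ?r\<^sup>+"
    using assms(1) by (simp only: grothendieck_rel_def)
  then have "(iso_add C a c, iso_add C b c) \<in> ?r\<^sup>+"
  proof (induction rule: trancl_induct)
    case (base b)
    then show ?case
      by (intro r_into_trancl add_c)
  next
    case (step b b')
    then show ?case
      by (intro trancl_into_trancl[OF step.IH] add_c)
  qed
  then show ?thesis
    by (simp only: grothendieck_rel_def)
qed

lemma iso_add_commute: "iso_add C a b = iso_add C b a"
  unfolding iso_add_def using direct_sum_commute by blast

text \<open>The summands are changed one after the other, the second with the help of
  commutativity.\<close>

lemma grothendieck_rel_add:
  assumes "(a, a') \<in> grothendieck_rel C" "(b, b') \<in> grothendieck_rel C"
  shows "(iso_add C a b, iso_add C a' b') \<in> grothendieck_rel C"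
proof -
  have "a' \<in> Iso C" "b \<in> Iso C"
    using assms equiv_grothendieck_rel by (auto simp: equiv_def)
  then have "(iso_add C a b, iso_add C a' b) \<in> grothendieck_rel C"
    "(iso_add C a' b, iso_add C a' b') \<in> grothendieck_rel C"
    using assms grothendieck_rel_add_right iso_add_commute by metis+
  then show ?thesis
    using equiv_grothendieck_rel by (meson equivE transE)
qed

text \<open>The product is a union over all pairs of representatives. By the congruence property all
  its members are the same class, and the union is not empty.\<close>

lemma mult_grothendieck_class:
  assumes "direct_sum C X Y S"
  shows "grothendieck_class C X \<otimes>\<^bsub>Grothendieck_monoid C\<^esub> grothendieck_class C Y
    = grothendieck_class C S"
proof -
  have objs: "X \<in> objects C" "Y \<in> objects C"
    using direct_sum_objects[OF assms] by simp_all
  have "grothendieck_rel C `` {iso_add C a b} = grothendieck_class C S"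
    if "a \<in> grothendieck_class C X" "b \<in> grothendieck_class C Y" for a b
  proof -
    have "(iso_class C S, iso_add C a b) \<in> grothendieck_rel C"
      using grothendieck_rel_add[of "iso_class C X" a "iso_class C Y" b] that
      by (simp add: grothendieck_class_def iso_add_iso_class[OF assms])
    then show ?thesis
      unfolding grothendieck_class_def using equiv_class_eq[OF equiv_grothendieck_rel] by metis
  qed
  moreover have "iso_class C X \<in> grothendieck_class C X" "iso_class C Y \<in> grothendieck_class C Y"
    using objs equiv_class_self[OF equiv_grothendieck_rel] iso_class_in_Iso
    by (simp_all add: grothendieck_class_def)
  ultimately show ?thesis
    unfolding Grothendieck_monoid_def by auto
qed

lemma carrier_Grothendieck_monoid:
  "carrier (Grothendieck_monoid C) = grothendieck_class C ` objects C"
  by (auto simp: Grothendieck_monoid_def quotient_def Iso_def grothendieck_class_def)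

lemma grothendieck_class_zero:
  assumes "zero_object C Z"
  shows "grothendieck_class C Z = \<one>\<^bsub>Grothendieck_monoid C\<^esub>"
  by (simp add: Grothendieck_monoid_def grothendieck_class_def iso_class_zero[OF assms])

lemma monoid_Grothendieck_monoid: "monoid (Grothendieck_monoid C)"
proof -
  let ?G = "Grothendieck_monoid C"
  obtain Z where Z: "zero_object C Z"
    using ex_zero_object by blast
  then have Z_obj: "Z \<in> objects C"
    by (simp add: zero_object_def)
  show ?thesis
  proof (rule monoidI)
    show "\<one>\<^bsub>?G\<^esub> \<in> carrier ?G"
      using Z_obj by (simp add: carrier_Grothendieck_monoid flip: grothendieck_class_zero[OF Z])
  next
    fix \<alpha> \<beta>
    assume "\<alpha> \<in> carrier ?G" "\<beta> \<in> carrier ?G"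
    then obtain X Y where XY: "X \<in> objects C" "Y \<in> objects C"
      "\<alpha> = grothendieck_class C X" "\<beta> = grothendieck_class C Y"
      by (auto simp: carrier_Grothendieck_monoid)
    then obtain S where S: "direct_sum C X Y S"
      using ex_direct_sum by blast
    then show "\<alpha> \<otimes>\<^bsub>?G\<^esub> \<beta> \<in> carrier ?G"
      using XY direct_sum_objects[OF S]
      by (simp add: mult_grothendieck_class[OF S] carrier_Grothendieck_monoid)
  next
    fix \<alpha> \<beta> \<gamma>
    assume "\<alpha> \<in> carrier ?G" "\<beta> \<in> carrier ?G" "\<gamma> \<in> carrier ?G"
    then obtain X Y W where XYW: "X \<in> objects C" "Y \<in> objects C" "W \<in> objects C"
      "\<alpha> = grothendieck_class C X" "\<beta> = grothendieck_class C Y" "\<gamma> = grothendieck_class C W"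
      by (auto simp: carrier_Grothendieck_monoid)
    obtain S where S: "direct_sum C X Y S"
      using XYW ex_direct_sum by blast
    obtain T where T: "direct_sum C S W T"
      using XYW ex_direct_sum direct_sum_objects[OF S] by blast
    obtain U where U: "direct_sum C Y W U"
      using XYW ex_direct_sum by blast
    show "\<alpha> \<otimes>\<^bsub>?G\<^esub> \<beta> \<otimes>\<^bsub>?G\<^esub> \<gamma> = \<alpha> \<otimes>\<^bsub>?G\<^esub> (\<beta> \<otimes>\<^bsub>?G\<^esub> \<gamma>)"
      using XYW mult_grothendieck_class[OF S] mult_grothendieck_class[OF T]
        mult_grothendieck_class[OF U] mult_grothendieck_class[OF direct_sum_assoc[OF S T U]]
      by simp
  next
    fix \<alpha>
    assume "\<alpha> \<in> carrier ?G"
    then obtain X where X: "X \<in> objects C" "\<alpha> = grothendieck_class C X"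
      by (auto simp: carrier_Grothendieck_monoid)
    have sum: "direct_sum C X Z X"
      using X Z by (simp add: direct_sum_zero)
    show "\<alpha> \<otimes>\<^bsub>?G\<^esub> \<one>\<^bsub>?G\<^esub> = \<alpha>"
      using mult_grothendieck_class[OF sum] X by (simp add: grothendieck_class_zero[OF Z])
    show "\<one>\<^bsub>?G\<^esub> \<otimes>\<^bsub>?G\<^esub> \<alpha> = \<alpha>"
      using mult_grothendieck_class[OF direct_sum_commute[OF sum]] X
      by (simp add: grothendieck_class_zero[OF Z])
  qed
qed

end


section \<open>Monoids with a supermultiplicative size\<close>

text \<open>The properties of \<mu> that drive both claims, detached from categories.\<close>

locale sized_monoid = monoid G for G (structure) +
  fixes size :: "'a \<Rightarrow> nat"
  assumes size_pos: "\<alpha> \<in> carrier G \<Longrightarrow> 0 < size \<alpha>"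
    and size_eq_one: "\<alpha> \<in> carrier G \<Longrightarrow> size \<alpha> = 1 \<Longrightarrow> \<alpha> = \<one>"
    and size_mult: "\<alpha> \<in> carrier G \<Longrightarrow> \<beta> \<in> carrier G \<Longrightarrow> size \<alpha> * size \<beta> \<le> size (\<alpha> \<otimes> \<beta>)"
begin

text \<open>Supermultiplicativity bounds
  \<open>size \<alpha> * (size \<gamma> * size \<delta>)\<close> by \<open>size \<alpha>\<close>;
  cancelling the positive factor leaves a product of positive numbers that is at most 1.\<close>

lemma eq_one_if_absorbed:
  assumes "\<alpha> \<in> carrier G" "\<gamma> \<in> carrier G" "\<delta> \<in> carrier G" "\<alpha> = \<alpha> \<otimes> (\<gamma> \<otimes> \<delta>)"
  shows "\<gamma> = \<one>"
proof -
  have "size \<alpha> * (size \<gamma> * size \<delta>) \<le> size \<alpha> * size (\<gamma> \<otimes> \<delta>)"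
    using assms by (intro mult_le_mono2 size_mult)
  also have "\<dots> \<le> size \<alpha> * 1"
    using size_mult[of \<alpha> "\<gamma> \<otimes> \<delta>"] assms by simp
  finally have "size \<gamma> * size \<delta> \<le> 1"
    using size_pos[OF assms(1)] by simp
  moreover have "size \<gamma> \<le> size \<gamma> * size \<delta>"
    using size_pos[OF assms(3)] by simp
  ultimately have "size \<gamma> = 1"
    using size_pos[OF assms(2)] by linarith
  then show ?thesis
    by (rule size_eq_one[OF assms(2)])
qed

lemma naturally_ordered: "naturally_ordered G"
proof -
  have "refl_on (carrier G) (natural_preorder G)"
    by (rule refl_onI) (auto simp: natural_preorder_def intro: bexI[of _ \<one>])
  moreover have "trans (natural_preorder G)"
  proof (rule transI)
    fix \<alpha> \<beta> \<gamma>
    assume "(\<alpha>, \<beta>) \<in> natural_preorder G" "(\<beta>, \<gamma>) \<in> natural_preorder G"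
    then obtain \<delta> \<epsilon> where "\<alpha> \<in> carrier G" "\<delta> \<in> carrier G" "\<epsilon> \<in> carrier G"
      "\<beta> = \<alpha> \<otimes> \<delta>" "\<gamma> = \<beta> \<otimes> \<epsilon>"
      by (auto simp: natural_preorder_def)
    then show "(\<alpha>, \<gamma>) \<in> natural_preorder G"
      by (auto simp: natural_preorder_def m_assoc intro!: bexI[of _ "\<delta> \<otimes> \<epsilon>"])
  qed
  moreover have "antisym (natural_preorder G)"
  proof (rule antisymI)
    fix \<alpha> \<beta>
    assume "(\<alpha>, \<beta>) \<in> natural_preorder G" "(\<beta>, \<alpha>) \<in> natural_preorder G"
    then obtain \<gamma> \<delta> where carrier: "\<alpha> \<in> carrier G" "\<gamma> \<in> carrier G" "\<delta> \<in> carrier G"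
      and eq: "\<beta> = \<alpha> \<otimes> \<gamma>" "\<alpha> = \<beta> \<otimes> \<delta>"
      unfolding natural_preorder_def by blast
    \<comment> \<open>Substituting one relation into the other turns mutual comparability into
      absorption.\<close>
    have "\<alpha> = \<alpha> \<otimes> (\<gamma> \<otimes> \<delta>)"
      using eq(2) unfolding eq(1) m_assoc[OF carrier] .
    then have "\<gamma> = \<one>"
      by (rule eq_one_if_absorbed[OF carrier])
    then show "\<alpha> = \<beta>"
      using eq(1) carrier(1) by simp
  qed
  ultimately show ?thesis
    by (auto simp: naturally_ordered_def partial_order_on_def preorder_on_def
        natural_preorder_def)
qed

text \<open>An element other than \<open>\<one>\<close> has size at least 2, so multiplying by it at
  least doubles the size.\<close>

lemma size_less_mult:
  assumes "\<alpha> \<in> carrier G" "\<beta> \<in> carrier G" "\<alpha> \<noteq> \<one>" "\<beta> \<noteq> \<one>"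
  shows "size \<alpha> < size (\<alpha> \<otimes> \<beta>)" "size \<beta> < size (\<alpha> \<otimes> \<beta>)"
proof -
  have "1 < size \<alpha>" "1 < size \<beta>"
    using assms size_pos size_eq_one by (metis less_one linorder_neqE_nat not_less_zero)+
  then have "size \<alpha> < size \<alpha> * size \<beta>" "size \<beta> < size \<alpha> * size \<beta>"
    by simp_all
  then show "size \<alpha> < size (\<alpha> \<otimes> \<beta>)" "size \<beta> < size (\<alpha> \<otimes> \<beta>)"
    using size_mult[OF assms(1,2)] by linarith+
qed

text \<open>Strong induction on the size: an element that is neither \<open>\<one>\<close> nor
  minimal splits into two factors of smaller size.\<close>

lemma generated_by_minimal: "generated_submonoid G (minimal_nonzero G) = carrier G"
proof
  have "submonoid (carrier G) G"
    by (simp add: submonoid_def)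
  moreover have "minimal_nonzero G \<subseteq> carrier G"
    by (auto simp: minimal_nonzero_def)
  ultimately show "generated_submonoid G (minimal_nonzero G) \<subseteq> carrier G"
    unfolding generated_submonoid_def by blast
  \<comment> \<open>The generated submonoid is an intersection, so membership is tested in an
    arbitrary \<open>H\<close>.\<close>
  have "\<alpha> \<in> H" if H: "submonoid H G" "minimal_nonzero G \<subseteq> H" and "\<alpha> \<in> carrier G" for H \<alpha>
    using that(3)
  proof (induction "size \<alpha>" arbitrary: \<alpha> rule: less_induct)
    case less
    consider "\<alpha> = \<one>" | "\<alpha> \<in> minimal_nonzero G"
      | \<beta> where "\<beta> \<in> carrier G" "\<beta> \<noteq> \<one>" "(\<beta>, \<alpha>) \<in> natural_preorder G" "\<beta> \<noteq> \<alpha>"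
      using less.prems unfolding minimal_nonzero_def by blast
    then show ?case
    proof cases
      case 1
      then show ?thesis
        using submonoid.one_closed[OF H(1)] by simp
    next
      case 2
      then show ?thesis
        using H(2) by blast
    next
      case 3
      then obtain \<gamma> where \<gamma>: "\<gamma> \<in> carrier G" "\<alpha> = \<beta> \<otimes> \<gamma>"
        by (auto simp: natural_preorder_def)
      \<comment> \<open>Otherwise \<open>\<alpha> = \<beta>\<close>, which this case
        excludes.\<close>
      moreover have "\<gamma> \<noteq> \<one>"
        using 3 \<gamma>(2) by auto
      ultimately have "\<beta> \<in> H" "\<gamma> \<in> H"
        using 3 size_less_mult[of \<beta> \<gamma>] less.hyps by simp_all
      then show ?thesis
        using \<gamma>(2) submonoid.m_closed[OF H(1)] by simp
    qed
  qed
  then show "carrier G \<subseteq> generated_submonoid G (minimal_nonzero G)"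
    unfolding generated_submonoid_def by blast
qed

end

section \<open>Endomorphism counts over the fibres\<close>

context profinitary_exact_category
begin

text \<open>This is \<mu>. \<open>Max\<close> is meaningful on finite nonempty sets, which is the
  case for \<gamma> in the carrier.\<close>

definition max_card_End :: "'o set set \<Rightarrow> nat"
  where "max_card_End \<gamma> = Max {card (Hom C X X) | X. X \<in> objects C \<and> grothendieck_class C X = \<gamma>}"

lemma card_Hom_isomorphic:
  assumes "isomorphic C X Y" "X \<in> objects C" "Y \<in> objects C"
  shows "card (Hom C X X) = card (Hom C Y Y)"
  using card_Hom_le_of_isomorphic[OF assms(1)] card_Hom_le_of_isomorphic[OF isomorphic_sym[OF assms(1)]]
    finite_Hom assms(2,3) by simp

text \<open>Profinitarity bounds isomorphism classes, not objects. As the count depends only on the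
  class, all counts lie in the image of a finite set.\<close>

lemma finite_card_Hom_fibre:
  assumes "\<gamma> \<in> carrier (Grothendieck_monoid C)"
  shows "finite {card (Hom C X X) | X. X \<in> objects C \<and> grothendieck_class C X = \<gamma>}"
proof -
  \<comment> \<open>An arbitrarily chosen representative makes the count a function of the
    class.\<close>
  define card_End where "card_End c = card (Hom C (SOME X. X \<in> c) (SOME X. X \<in> c))" for c
  have "card (Hom C X X) = card_End (iso_class C X)" if X: "X \<in> objects C" for X
  proof -
    have "X \<in> iso_class C X"
      using X isomorphic_refl by (simp add: iso_class_def)
    then have "(SOME Y. Y \<in> iso_class C X) \<in> iso_class C X"
      by (rule someI)
    then show ?thesis
      unfolding card_End_def using X by (intro card_Hom_isomorphic) (simp_all add: iso_class_def)
  qed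
  then have "{card (Hom C X X) | X. X \<in> objects C \<and> grothendieck_class C X = \<gamma>}
      \<subseteq> card_End ` {iso_class C X | X. X \<in> objects C \<and> grothendieck_class C X = \<gamma>}"
    by blast
  then show ?thesis
    using finite_fibres[OF assms] by (rule finite_surj[rotated])
qed

lemma grothendieck_class_in_carrier:
  "X \<in> objects C \<Longrightarrow> grothendieck_class C X \<in> carrier (Grothendieck_monoid C)"
  by (simp add: carrier_Grothendieck_monoid)

lemma card_Hom_le_max_card_End:
  assumes "X \<in> objects C"
  shows "card (Hom C X X) \<le> max_card_End (grothendieck_class C X)"
  unfolding max_card_End_def using assms finite_card_Hom_fibre[OF grothendieck_class_in_carrier[OF assms]]
  by (intro Max_ge) auto

lemma max_card_End_attained:
  assumes "\<gamma> \<in> carrier (Grothendieck_monoid C)"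
  obtains X where "X \<in> objects C" "grothendieck_class C X = \<gamma>" "max_card_End \<gamma> = card (Hom C X X)"
proof -
  let ?S = "{card (Hom C X X) | X. X \<in> objects C \<and> grothendieck_class C X = \<gamma>}"
  have "?S \<noteq> {}"
    using assms by (auto simp: carrier_Grothendieck_monoid)
  then have "max_card_End \<gamma> \<in> ?S"
    unfolding max_card_End_def using finite_card_Hom_fibre[OF assms] by (intro Max_in)
  then show ?thesis
    using that by blast
qed

text \<open>In a one-element set the identity and the zero arrow coincide.\<close>

lemma zero_object_if_card_Hom:
  assumes X: "X \<in> objects C" and card: "card (Hom C X X) = 1"
  shows "zero_object C X"
proof -
  obtain f where "Hom C X X = {f}"
    using card by (auto simp: card_1_singleton_iff)
  moreover have "ident C X \<in> Hom C X X" "arr_zero C X X \<in> Hom C X X"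
    using X by (simp_all add: Hom_iff)
  ultimately have "ident C X = arr_zero C X X"
    by simp
  then show ?thesis
    using X by (simp add: zero_object_iff)
qed

lemma sized_Grothendieck_monoid: "sized_monoid (Grothendieck_monoid C) max_card_End"
proof (intro sized_monoid.intro sized_monoid_axioms.intro monoid_Grothendieck_monoid)
  let ?G = "Grothendieck_monoid C"
  fix \<alpha>
  assume "\<alpha> \<in> carrier ?G"
  then obtain X where X: "X \<in> objects C" "grothendieck_class C X = \<alpha>" "max_card_End \<alpha> = card (Hom C X X)"
    by (rule max_card_End_attained)
  have "ident C X \<in> Hom C X X"
    using X(1) by (rule ident_in)
  then show "0 < max_card_End \<alpha>"
    using X finite_Hom[OF X(1) X(1)] by (auto simp: card_gt_0_iff)
  show "\<alpha> = \<one>\<^bsub>?G\<^esub>" if "max_card_End \<alpha> = 1"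
    using X that zero_object_if_card_Hom grothendieck_class_zero by metis
  fix \<beta>
  assume "\<beta> \<in> carrier ?G"
  then obtain Y where Y: "Y \<in> objects C" "grothendieck_class C Y = \<beta>" "max_card_End \<beta> = card (Hom C Y Y)"
    by (rule max_card_End_attained)
  \<comment> \<open>\<open>X\<close> and \<open>Y\<close> attain the maxima over \<alpha> and
    \<beta>; their direct sum lies over the sum of \<alpha> and \<beta>, so its count is bounded by
    the maximum there.\<close>
  obtain S where S: "direct_sum C X Y S"
    using ex_direct_sum X Y by blast
  then have S_obj: "S \<in> objects C"
    using direct_sum_objects by blast
  have "max_card_End \<alpha> * max_card_End \<beta> \<le> card (Hom C S S)"
    using X Y card_Hom_direct_sum[OF S finite_Hom[OF S_obj S_obj]] by simp
  also have "\<dots> \<le> max_card_End (grothendieck_class C S)"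
    using S_obj by (rule card_Hom_le_max_card_End)
  also have "grothendieck_class C S = \<alpha> \<otimes>\<^bsub>?G\<^esub> \<beta>"
    using X Y mult_grothendieck_class[OF S] by simp
  finally show "max_card_End \<alpha> * max_card_End \<beta> \<le> max_card_End (\<alpha> \<otimes>\<^bsub>?G\<^esub> \<beta>)" .
qed

end

theorem proposition2p12:
  fixes A :: "('o, 'm, 'x) exact_data_scheme"
  assumes "profinitary_exact_category A"
  shows "naturally_ordered (Grothendieck_monoid A) \<and>
    generated_submonoid (Grothendieck_monoid A) (minimal_nonzero (Grothendieck_monoid A)) =
      carrier (Grothendieck_monoid A)"
proof -
  interpret sized_monoid "Grothendieck_monoid A" "profinitary_exact_category.max_card_End A"
    using assms by (rule profinitary_exact_category.sized_Grothendieck_monoid)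
  show ?thesis
    using naturally_ordered generated_by_minimal by blast
qed

end
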